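(* Let $\{X_i, f_i\}_{i=1}^{\infty}$ be an inverse sequence of compacta with surjective monotone upper semi-continuous bonding functions $f_i : X_{i+1} \to 2^{X_i}$. If $X_i$ is a $D^{**}$-continuum for each $i \ge 1$, then the inverse limit $\varprojlim \{X_i, f_i\}_{i=1}^{\infty}$ is also a $D^{**}$-continuum.
   Context: All spaces are metrizable; a compactum is a compact metrizable space. A continuum is a (nonempty) compact connected metric space; it is nondegenerate if it has more than one point. A subcontinuum of $X$ is a subset of $X$ that is a continuum. A (continuous single-valued) map $g : X \to Y$ is monotone if $g^{-1}(y)$ is connected for each $y \in Y$. A continuum $X$ is a $D^{**}$-continuum if for any disjoint nondegenerate subcontinua $A$ and $B$ of $X$ there exists a subcontinuum $C$ of $X$ such that $A \cap C \neq \emptyset \neq B \cap C$ and $B \setminus C \neq \emptyset$. For a compactum $Y$, $2^Y$ denotes the set of nonempty closed subsets of $Y$. For compacta $X, Y$, a set-valued function $f : X \to 2^Y$ is upper semi-continuous if for each $x \in X$ and each open subset $V$ of $Y$ containing $f(x)$ there is an open subset $U$ of $X$ containing $x$ such that $f(z) \subset V$ for all $z \in U$. Its graph is $G(f) = \{(x,y) \in X \times Y \mid y \in f(x)\}$. It is surjective if for each $y \in Y$ there exists $x \in X$ with $y \in f(x)$. An upper semi-continuous function $f : X \to 2^Y$ is monotone if both projections $G(f) \to X$ and $G(f) \to Y$ are monotone maps. An inverse sequence $\{X_i, f_i\}_{i=1}^{\infty}$ consists of compacta $X_i$ and upper semi-continuous functions $f_i : X_{i+1} \to 2^{X_i}$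 (the bonding functions). Its inverse limit is the subspace $$\varprojlim \{X_i, f_i\}_{i=1}^{\infty} = \Big\{(x_i)_{i=1}^{\infty} \in \prod_{i=1}^{\infty} X_i \;\Big|\; x_i \in f_i(x_{i+1}) \text{ for each } i \ge 1\Big\}$$ of the product space $\prod_{i=1}^{\infty} X_i$. *)

theory Defs
  imports "HOL-Analysis.Analysis"
begin

definition compactum :: "'a topology \<Rightarrow> bool" where
  "compactum X \<longleftrightarrow> compact_space X \<and> metrizable_space X"

definition continuum :: "'a topology \<Rightarrow> bool" where
  "continuum X \<longleftrightarrow> compactum X \<and> connected_space X \<and> topspace X \<noteq> {}"

definition subcontinuum :: "'a topology \<Rightarrow> 'a set \<Rightarrow> bool" where
  "subcontinuum X A \<longleftrightarrow> A \<subseteq> topspace X \<and> continuum (subtopology X A)"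

definition nondegenerate :: "'a set \<Rightarrow> bool" where
  "nondegenerate A \<longleftrightarrow> (\<exists>x\<in>A. \<exists>y\<in>A. x \<noteq> y)"

text \<open>\<open>D\<^sup>*\<^sup>*\<close>-continua. The condition is asymmetric in \<open>A\<close> and \<open>B\<close>, but it is required of all
  ordered pairs.\<close>

definition D_star_star_continuum :: "'a topology \<Rightarrow> bool" where
  "D_star_star_continuum X \<longleftrightarrow>
     continuum X \<and>
     (\<forall>A B. subcontinuum X A \<and> nondegenerate A \<and> subcontinuum X B \<and> nondegenerate B \<and> A \<inter> B = {}
        \<longrightarrow> (\<exists>C. subcontinuum X C \<and> A \<inter> C \<noteq> {} \<and> B \<inter> C \<noteq> {} \<and> B - C \<noteq> {}))"

text \<open>The hyperspace \<open>2\<^sup>Y\<close>, as a bare set.\<close>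

definition closed_hyperspace :: "'a topology \<Rightarrow> 'a set set" where
  "closed_hyperspace Y = {A. closedin Y A \<and> A \<noteq> {}}"

text \<open>A set-valued function \<open>F : X \<rightarrow> 2\<^sup>Y\<close> is a HOL function whose values matter only on
  \<open>topspace X\<close>.\<close>

definition upper_semicontinuous ::
    "'a topology \<Rightarrow> 'b topology \<Rightarrow> ('a \<Rightarrow> 'b set) \<Rightarrow> bool" where
  "upper_semicontinuous X Y F \<longleftrightarrow>
     F \<in> topspace X \<rightarrow> closed_hyperspace Y \<and>
     (\<forall>x \<in> topspace X. \<forall>V. openin Y V \<and> F x \<subseteq> V
        \<longrightarrow> (\<exists>U. openin X U \<and> x \<in> U \<and> (\<forall>z\<in>U. F z \<subseteq> V)))"

definition sv_graph :: "'a topology \<Rightarrow> 'b topology \<Rightarrow> ('a \<Rightarrow> 'b set) \<Rightarrow> ('a \<times> 'b) topology" where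
  "sv_graph X Y F =
     subtopology (prod_topology X Y) {(x, y). x \<in> topspace X \<and> y \<in> topspace Y \<and> y \<in> F x}"

definition sv_surjective :: "'a topology \<Rightarrow> 'b topology \<Rightarrow> ('a \<Rightarrow> 'b set) \<Rightarrow> bool" where
  "sv_surjective X Y F \<longleftrightarrow> (\<forall>y \<in> topspace Y. \<exists>x \<in> topspace X. y \<in> F x)"

text \<open>The library predicate \<^const>\<open>monotone_map\<close> does not include continuity; the two projections
  below are continuous automatically.\<close>

definition sv_monotone :: "'a topology \<Rightarrow> 'b topology \<Rightarrow> ('a \<Rightarrow> 'b set) \<Rightarrow> bool" where
  "sv_monotone X Y F \<longleftrightarrow>
     upper_semicontinuous X Y F \<and>
     monotone_map (sv_graph X Y F) X fst \<and>
     monotone_map (sv_graph X Y F) Y snd"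

text \<open>Inverse sequences are indexed from \<open>0\<close> rather than from \<open>1\<close>. The spaces \<open>X i\<close> have carriers
  in one common type but are otherwise unrelated.\<close>

definition inverse_sequence ::
    "(nat \<Rightarrow> 'a topology) \<Rightarrow> (nat \<Rightarrow> 'a \<Rightarrow> 'a set) \<Rightarrow> bool" where
  "inverse_sequence X f \<longleftrightarrow>
     (\<forall>i. compactum (X i)) \<and> (\<forall>i. upper_semicontinuous (X (Suc i)) (X i) (f i))"

definition inverse_limit ::
    "(nat \<Rightarrow> 'a topology) \<Rightarrow> (nat \<Rightarrow> 'a \<Rightarrow> 'a set) \<Rightarrow> (nat \<Rightarrow> 'a) topology" where
  "inverse_limit X f =
     subtopology (product_topology X UNIV)
       {x \<in> topspace (product_topology X UNIV). \<forall>i. x i \<in> f i (x (Suc i))}"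

end

theory Submission
  imports Defs
begin

text \<open>Disjoint subcontinua of the inverse limit can have overlapping images in every coordinate (take
  all bonding functions constant with value the whole space), so the condition cannot be
  pulled back directly from a factor in which the images are still disjoint. What makes it pull
  back is a reformulation (\<open>D_star_star_continuum_pointwise\<close>) with no disjointness: for every
  point \<open>a\<close> and every nondegenerate subcontinuum \<open>B\<close> some subcontinuum contains \<open>a\<close>, meets \<open>B\<close>
  and does not contain \<open>B\<close>. If \<open>a \<in> B\<close> the singleton \<open>{a}\<close> does this. Otherwise boundary bumping
  gives a nondegenerate subcontinuum \<open>K\<close> through \<open>a\<close> missing \<open>B\<close>; apply the original condition to
  \<open>K\<close> and \<open>B\<close> and adjoin \<open>K\<close> to the resulting continuum.

  Now let \<open>a\<close> and \<open>B\<close> be given in the inverse limit. Since \<open>B\<close> has two points, some projection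
  \<open>\<pi>\<^sub>n\<close> is not constant on \<open>B\<close>. The pointwise condition in \<open>X n\<close>, applied to \<open>\<pi>\<^sub>n a\<close> and
  \<open>\<pi>\<^sub>n B\<close>, yields \<open>C\<close>, and the preimage of \<open>C\<close> under \<open>\<pi>\<^sub>n\<close> has the required properties in the
  limit, provided that it is a continuum.

  That proviso (\<open>subcontinuum_projection_preimage\<close>) is where the bonding functions enter. Starting
  from all points of the product with \<open>n\<close>-th coordinate in \<open>C\<close>, impose the conditions
  \<open>x i \<in> f i (x (Suc i))\<close> one at a time, moving away from the index \<open>n\<close>: first downwards to \<open>0\<close>,
  then upwards. Each condition restricts one coordinate that is still free, and the allowed values
  form a nonempty connected set by monotonicity and surjectivity of \<open>f i\<close>; hence connectedness is
  kept (\<open>connectedin_coordinate_constraint\<close>). The preimage is a decreasing intersection of the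
  closed connected sets so obtained.\<close>

section \<open>Subcontinua of compacta\<close>

lemma compactum_imp_Hausdorff: "compactum X \<Longrightarrow> Hausdorff_space X"
  by (simp add: compactum_def metrizable_imp_Hausdorff_space)

lemma subcontinuum_iff:
  assumes "compactum X"
  shows "subcontinuum X A \<longleftrightarrow> closedin X A \<and> connectedin X A \<and> A \<noteq> {}"
proof
  assume "subcontinuum X A"
  then have "compactin X A" "connectedin X A" "A \<noteq> {}"
    by (auto simp: subcontinuum_def continuum_def compactum_def compactin_subspace connectedin_def)
  then show "closedin X A \<and> connectedin X A \<and> A \<noteq> {}"
    using assms compactin_imp_closedin compactum_imp_Hausdorff by blast
next
  assume A: "closedin X A \<and> connectedin X A \<and> A \<noteq> {}"
  then have "compactin X A"
    using assms closedin_compact_space compactum_def by blast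
  then show "subcontinuum X A"
    using A assms
    by (auto simp: subcontinuum_def continuum_def compactum_def connectedin_def
        compactin_subspace metrizable_space_subtopology)
qed

lemma subcontinuum_subtopology:
  assumes "S \<subseteq> topspace X"
  shows "subcontinuum (subtopology X S) A \<longleftrightarrow> A \<subseteq> S \<and> subcontinuum X A"
  using assms by (auto simp: subcontinuum_def subtopology_subtopology Int_absorb1)

lemma subcontinuum_continuous_image:
  assumes "compactum X" "compactum Y" "continuous_map X Y g" "subcontinuum X A"
  shows "subcontinuum Y (g ` A)"
proof -
  have A: "closedin X A" "connectedin X A" "A \<noteq> {}"
    using assms subcontinuum_iff by blast+
  have "closed_map X Y g"
    using assms by (simp add: compactum_def continuous_imp_closed_map metrizable_imp_Hausdorff_space)
  then show ?thesis
    using A assms by (auto simp: subcontinuum_iff closed_map_def connectedin_continuous_map_image)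
qed

text \<open>A separation of the intersection into two closed pieces extends to disjoint open sets by
  normality, and by compactness some \<open>K n\<close> already lies in their union, which
  separates it.\<close>

lemma connectedin_nest:
  fixes K :: "nat \<Rightarrow> 'a set"
  assumes X: "compact_space X" "Hausdorff_space X"
    and clo: "\<And>n. closedin X (K n)" and con: "\<And>n. connectedin X (K n)" and dec: "decseq K"
  shows "connectedin X (\<Inter>n. K n)"
proof (rule ccontr)
  assume not_connected: "\<not> connectedin X (\<Inter>n. K n)"
  have cl: "closedin X (\<Inter>n. K n)"
    by (rule closedin_Inter) (use clo in auto)
  obtain E F where EF: "closedin X E" "closedin X F" "(\<Inter>n. K n) \<subseteq> E \<union> F"
      "E \<inter> F \<inter> (\<Inter>n. K n) = {}" "E \<inter> (\<Inter>n. K n) \<noteq> {}" "F \<inter> (\<Inter>n. K n) \<noteq> {}"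
    using not_connected closedin_subset[OF cl] unfolding connectedin_closedin by metis
  have "normal_space X"
    using X compact_Hausdorff_or_regular_imp_normal_space by blast
  moreover have "closedin X (E \<inter> (\<Inter>n. K n))" "closedin X (F \<inter> (\<Inter>n. K n))"
    using EF cl by blast+
  moreover have "disjnt (E \<inter> (\<Inter>n. K n)) (F \<inter> (\<Inter>n. K n))"
    using EF(4) by (auto simp: disjnt_def)
  ultimately obtain U V where UV: "openin X U" "openin X V" "E \<inter> (\<Inter>n. K n) \<subseteq> U"
      "F \<inter> (\<Inter>n. K n) \<subseteq> V" "disjnt U V"
    unfolding normal_space_def by metis
  have "\<exists>n. K n - (U \<union> V) = {}"
  proof (rule ccontr)
    assume "\<not> ?thesis"
    then have "(\<Inter>n. K n - (U \<union> V)) \<noteq> {}"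
      using compact_space_imp_nest[OF X(1), of "\<lambda>n. K n - (U \<union> V)"] dec clo UV
      by (auto simp: decseq_def closedin_diff openin_Un)
    then show False
      using EF(3) UV(3,4) by blast
  qed
  then obtain n where n: "K n \<subseteq> U \<union> V"
    by blast
  have "U \<inter> K n \<noteq> {}" "V \<inter> K n \<noteq> {}"
    using EF(5,6) UV(3,4) by blast+
  moreover have "U \<inter> V \<inter> K n = {}"
    using UV(5) by (auto simp: disjnt_def)
  ultimately show False
    using con[of n] n UV(1,2) unfolding connectedin by blast
qed

section \<open>A pointwise form of the condition\<close>

text \<open>Boundary bumping: the component of \<open>a\<close> in a small closed neighbourhood reaches the frontier of
  that neighbourhood, so it is more than a point.\<close>

lemma nondegenerate_subcontinuum_avoiding:
  assumes X: "continuum X" and B: "closedin X B" "B \<noteq> {}" and a: "a \<in> topspace X - B"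
  obtains K where "subcontinuum X K" "nondegenerate K" "a \<in> K" "K \<inter> B = {}"
proof -
  have X': "compactum X" "compact_space X" "connected_space X" "Hausdorff_space X" "regular_space X"
    using X compactum_imp_Hausdorff
    by (auto simp: continuum_def compactum_def metrizable_imp_regular_space)
  have "openin X (topspace X - B)"
    using B by blast
  then obtain U V where UV: "openin X U" "closedin X V" "a \<in> U" "U \<subseteq> V" "V \<subseteq> topspace X - B"
    using X'(5) a unfolding neighbourhood_base_of_closedin[symmetric] neighbourhood_base_of
    by metis
  define K where "K = connected_component_of_set (subtopology X V) a"
  have aV: "a \<in> topspace (subtopology X V)"
    using a UV by auto
  have K_comp: "K \<in> connected_components_of (subtopology X V)"
    using aV by (simp add: K_def connected_component_in_connected_components_of)
  have aK: "a \<in> K"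
    using aV by (simp add: K_def connected_component_of_refl)
  have "closedin (subtopology X V) K" "connectedin (subtopology X V) K"
    using K_comp by (auto simp: closedin_connected_components_of connectedin_connected_components_of)
  then have K: "closedin X K" "connectedin X K" "K \<subseteq> V"
    using UV(2) closedin_trans_full by (auto simp: connectedin_subtopology)
  have "V \<noteq> topspace X"
    using UV(5) B closedin_subset by fastforce
  then have "K \<inter> X frontier_of V \<noteq> {}"
    using boundary_bumping_theorem_closed X' UV K_comp by blast
  then obtain b where b: "b \<in> K" "b \<in> X frontier_of V"
    by auto
  have "a \<notin> X frontier_of V"
    using UV(1,3,4) by (auto simp: frontier_of_def interior_of_def)
  then have "a \<noteq> b"
    using b(2) by auto
  then have "nondegenerate K"
    using aK b(1) unfolding nondegenerate_def by (intro bexI)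
  moreover have "subcontinuum X K"
    using K(1,2) aK subcontinuum_iff[OF X'(1)] by auto
  moreover have "K \<inter> B = {}"
    using K(3) UV(5) by auto
  ultimately show ?thesis
    using that[of K] aK by simp
qed

text \<open>Disjointness of two sets may be lost under a map. The data of this form, a point \<open>a\<close> and a
  nondegenerate \<open>B\<close>, go over to data of the same kind whenever the map is not constant on \<open>B\<close>.\<close>

lemma D_star_star_continuum_pointwise:
  "D_star_star_continuum X \<longleftrightarrow>
     continuum X \<and>
     (\<forall>a\<in>topspace X. \<forall>B. subcontinuum X B \<and> nondegenerate B
        \<longrightarrow> (\<exists>C. subcontinuum X C \<and> a \<in> C \<and> B \<inter> C \<noteq> {} \<and> B - C \<noteq> {}))"
  (is "_ \<longleftrightarrow> _ \<and> ?R")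
proof (intro iffI conjI)
  assume D: "D_star_star_continuum X"
  then show X: "continuum X"
    by (simp add: D_star_star_continuum_def)
  then have cX: "compactum X"
    by (simp add: continuum_def)
  show ?R
  proof (intro ballI allI impI, elim conjE)
    fix a B assume a: "a \<in> topspace X" and B: "subcontinuum X B" "nondegenerate B"
    show "\<exists>C. subcontinuum X C \<and> a \<in> C \<and> B \<inter> C \<noteq> {} \<and> B - C \<noteq> {}"
    proof (cases "a \<in> B")
      case True
      have "subcontinuum X {a}"
        using a cX by (simp add: subcontinuum_iff closedin_Hausdorff_singleton compactum_imp_Hausdorff)
      moreover have "B - {a} \<noteq> {}"
        using B(2) unfolding nondegenerate_def by blast
      ultimately show ?thesis
        using True by blast
    next
      case False
      obtain K where K: "subcontinuum X K" "nondegenerate K" "a \<in> K" "K \<inter> B = {}"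
        using nondegenerate_subcontinuum_avoiding[OF X, of B a] a False B cX
        by (auto simp: subcontinuum_iff)
      obtain C where C: "subcontinuum X C" "K \<inter> C \<noteq> {}" "B \<inter> C \<noteq> {}" "B - C \<noteq> {}"
        using D K B unfolding D_star_star_continuum_def by metis
      have "subcontinuum X (C \<union> K)"
        using C(1,2) K(1) cX connectedin_Un[of X C K] by (auto simp: subcontinuum_iff)
      then show ?thesis
        using C K(3,4) by (intro exI[of _ "C \<union> K"]) blast
    qed
  qed
next
  assume R: "continuum X \<and> ?R"
  show "D_star_star_continuum X"
    unfolding D_star_star_continuum_def
  proof (intro conjI allI impI, goal_cases)
    case 1
    then show ?case using R by blast
  next
    case (2 A B)
    then obtain a where "a \<in> A" "a \<in> topspace X"
      unfolding nondegenerate_def subcontinuum_def by blast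
    then show ?case
      using R 2 by blast
  qed
qed

section \<open>Constraining one coordinate of a product\<close>

text \<open>A value \<open>F x\<close> and a point \<open>y\<close> outside it have disjoint open neighbourhoods, and by upper
  semi-continuity the values at points near \<open>x\<close> stay in the first one.\<close>

lemma closedin_graph:
  assumes F: "upper_semicontinuous X Y F" and Y: "regular_space Y"
  shows "closedin (prod_topology X Y) {(x, y). x \<in> topspace X \<and> y \<in> topspace Y \<and> y \<in> F x}"
    (is "closedin _ ?G")
proof -
  have "\<exists>T. openin (prod_topology X Y) T \<and> p \<in> T \<and> T \<subseteq> topspace (prod_topology X Y) - ?G"
    if p: "p \<in> topspace (prod_topology X Y) - ?G" for p
  proof -
    obtain x y where p_eq: "p = (x, y)"
      by (cases p)
    then have xy: "x \<in> topspace X" "y \<in> topspace Y" "y \<notin> F x"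
      using p by simp_all
    have "closedin Y (F x)"
      using F xy(1) by (auto simp: upper_semicontinuous_def closed_hyperspace_def)
    then obtain U V where UV: "openin Y U" "openin Y V" "y \<in> U" "F x \<subseteq> V" "disjnt U V"
      using Y xy(2,3) unfolding regular_space_def by (metis DiffI)
    then obtain W where W: "openin X W" "x \<in> W" "\<And>z. z \<in> W \<Longrightarrow> F z \<subseteq> V"
      using F xy(1) unfolding upper_semicontinuous_def by metis
    have "openin (prod_topology X Y) (W \<times> U)"
      using UV W by (simp add: openin_prod_Times_iff)
    moreover have "W \<times> U \<subseteq> topspace (prod_topology X Y) - ?G"
    proof -
      have "W \<subseteq> topspace X" "U \<subseteq> topspace Y"
        using UV(1) W(1) openin_subset by blast+
      moreover have "y' \<notin> F z" if "z \<in> W" "y' \<in> U" for z y'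
        using W(3)[OF that(1)] UV(5) that(2) by (auto simp: disjnt_iff)
      ultimately show ?thesis
        by auto
    qed
    ultimately show ?thesis
      using p_eq UV(3) W(2) by blast
  qed
  then have "openin (prod_topology X Y) (topspace (prod_topology X Y) - ?G)"
    by (subst openin_subopen) blast
  moreover have "?G \<subseteq> topspace (prod_topology X Y)"
    by auto
  ultimately show ?thesis
    unfolding closedin_def by blast
qed

text \<open>The fibres of the two projections of the graph of \<open>F\<close> are copies of the values of \<open>F\<close> and of
  the sets \<open>{x. y \<in> F x}\<close>. These are the sets to which new coordinates are confined below the
  starting index and above it, respectively.\<close>

lemma sv_monotone_connectedin_value:
  assumes "sv_monotone X Y F" "x \<in> topspace X"
  shows "connectedin Y (F x)"
proof -
  have sub: "F x \<subseteq> topspace Y"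
    using assms closedin_subset
    by (fastforce simp: sv_monotone_def upper_semicontinuous_def closed_hyperspace_def)
  have "connectedin (sv_graph X Y F) {p \<in> topspace (sv_graph X Y F). fst p = x}"
    using assms by (simp add: sv_monotone_def monotone_map)
  then have "connectedin Y (snd ` {p \<in> topspace (sv_graph X Y F). fst p = x})"
    by (rule connectedin_continuous_map_image[rotated])
      (simp add: sv_graph_def continuous_map_from_subtopology continuous_map_snd)
  also have "snd ` {p \<in> topspace (sv_graph X Y F). fst p = x} = F x"
    using assms(2) sub by (force simp: sv_graph_def)
  finally show ?thesis .
qed

lemma sv_monotone_connectedin_preimage:
  assumes "sv_monotone X Y F" "y \<in> topspace Y"
  shows "connectedin X {x \<in> topspace X. y \<in> F x}"
proof -
  have "connectedin (sv_graph X Y F) {p \<in> topspace (sv_graph X Y F). snd p = y}"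
    using assms by (simp add: sv_monotone_def monotone_map)
  then have "connectedin X (fst ` {p \<in> topspace (sv_graph X Y F). snd p = y})"
    by (rule connectedin_continuous_map_image[rotated])
      (simp add: sv_graph_def continuous_map_from_subtopology continuous_map_fst)
  also have "fst ` {p \<in> topspace (sv_graph X Y F). snd p = y} = {x \<in> topspace X. y \<in> F x}"
    using assms(2) by (force simp: sv_graph_def)
  finally show ?thesis .
qed

text \<open>Think of \<open>T\<close> as a cylinder over a set in the remaining coordinates: neither \<open>T\<close> nor the set \<open>D x\<close>
  of allowed values depends on the \<open>k\<close>-th coordinate. Forgetting that coordinate maps \<open>S\<close> onto
  the base of the cylinder, which is connected, with fibres homeomorphic to the connected sets
  \<open>D x\<close>. As the map is a quotient map by compactness, \<open>S\<close> is connected.\<close>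

lemma connectedin_coordinate_constraint:
  fixes X :: "'i \<Rightarrow> 'a topology"
  defines "P \<equiv> product_topology X UNIV"
  assumes P: "compact_space P" "Hausdorff_space P"
    and T: "connectedin P T" "T \<noteq> {}"
    and S: "closedin P S" "S = {x \<in> T. x k \<in> D x}"
    and inv: "\<And>x z. \<lbrakk>x \<in> T; z \<in> topspace (X k)\<rbrakk> \<Longrightarrow> x(k := z) \<in> T \<and> D (x(k := z)) = D x"
    and D: "\<And>x. x \<in> T \<Longrightarrow> connectedin (X k) (D x) \<and> D x \<noteq> {}"
  shows "connectedin P S \<and> S \<noteq> {}"
proof -
  have topP: "x i \<in> topspace (X i)" if "x \<in> topspace P" for x i
    using that by (auto simp: P_def PiE_def)
  have TP: "T \<subseteq> topspace P"
    using T connectedin_subset_topspace by blast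
  have Dsub: "z \<in> topspace (X k)" if "x \<in> T" "z \<in> D x" for x z
    using D[OF that(1)] that connectedin_subset_topspace by blast
  have upd: "x(k := z) \<in> S" if "x \<in> T" "z \<in> D x" for x z
    using inv[of x z] Dsub[of x z] that S by auto
  obtain t where t: "t \<in> T"
    using T by blast
  define c where "c = t k"
  have c: "c \<in> topspace (X k)"
    using t TP topP c_def by blast
  \<comment> \<open>Overwriting coordinate \<open>k\<close> by a fixed value plays the role of forgetting it, without leaving
    the product.\<close>
  define u where "u = (\<lambda>x::'i \<Rightarrow> 'a. x(k := c))"
  have u_cont: "continuous_map P P u"
    using c
    by (auto simp: u_def P_def continuous_map_componentwise_UNIV continuous_map_product_projection)
  have uS: "u ` S = u ` T"
  proof
    show "u ` T \<subseteq> u ` S"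
    proof
      fix y assume "y \<in> u ` T"
      then obtain x z where "x \<in> T" "y = u x" "z \<in> D x"
        using D by blast
      moreover have "u (x(k := z)) = u x"
        by (simp add: u_def)
      ultimately show "y \<in> u ` S"
        using upd by (metis imageI)
    qed
  qed (use S in blast)
  have SP: "S \<subseteq> topspace P"
    using S TP by blast
  have uSP: "u ` S \<subseteq> topspace P"
    using SP u_cont by (auto simp: continuous_map_def)
  define Q where "Q = subtopology P (u ` S)"
  have topS: "topspace (subtopology P S) = S" and topQ: "topspace Q = u ` S"
    using SP uSP by (auto simp: Q_def)
  have quot: "quotient_map (subtopology P S) Q u"
  proof (rule T1_Spaces.continuous_imp_quotient_map)
    show "continuous_map (subtopology P S) Q u"
      by (simp add: Q_def continuous_map_in_subtopology continuous_map_from_subtopology u_cont topS)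
    show "compact_space (subtopology P S)"
      using P S(1) closedin_compact_space compact_space_subtopology by blast
    show "Hausdorff_space Q"
      using P by (simp add: Q_def Hausdorff_space_subtopology)
    show "u ` topspace (subtopology P S) = topspace Q"
      by (simp only: topS topQ)
  qed
  have mono: "monotone_map (subtopology P S) Q u"
    unfolding monotone_map_def topS topQ
  proof (intro conjI ballI)
    fix y assume "y \<in> u ` S"
    then obtain x where x: "x \<in> T" "y = u x"
      using S by blast
    have y: "y \<in> T" "y k = c"
      using x inv[of x c] c by (auto simp: u_def)
    have "{x \<in> S. u x = y} = (\<lambda>z. y(k := z)) ` D y"
    proof
      show "{x \<in> S. u x = y} \<subseteq> (\<lambda>z. y(k := z)) ` D y"
      proof clarify
        fix x' assume x': "x' \<in> S" "y = u x'"
        then have "x' k \<in> D x'" "D (u x') = D x'"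
          using S inv[of x' c] c by (auto simp: u_def)
        moreover have "x' = (u x')(k := x' k)"
          by (auto simp: u_def)
        ultimately show "x' \<in> (\<lambda>z. (u x')(k := z)) ` D (u x')"
          by (metis imageI)
      qed
      show "(\<lambda>z. y(k := z)) ` D y \<subseteq> {x \<in> S. u x = y}"
        using upd y by (auto simp: u_def)
    qed
    moreover have "continuous_map (X k) P (\<lambda>z. y(k := z))"
      using y(1) TP topP by (auto simp: P_def continuous_map_componentwise_UNIV)
    ultimately have "connectedin P {x \<in> S. u x = y}"
      using D[OF y(1)] connectedin_continuous_map_image by metis
    then show "connectedin (subtopology P S) {x \<in> S. u x = y}"
      by (auto simp: connectedin_subtopology)
  qed auto
  have "connectedin P (u ` T)"
    using T(1) u_cont connectedin_continuous_map_image by blast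
  then have "connected_space Q"
    by (simp add: Q_def uS connectedin_def)
  then have "connected_space (subtopology P S)"
    using connected_space_monotone_quotient_map_preimage mono quot by blast
  then show ?thesis
    using SP uS T by (auto simp: connectedin_def)
qed

section \<open>Projections of the inverse limit\<close>

text \<open>Only the relations between neighbouring coordinates in the index window from \<open>a\<close> to \<open>b\<close> are
  imposed; the coordinates outside the window stay free. Keeping all coordinates lets windows of
  different length be compared as subsets of a single space.\<close>

definition partial_threads ::
    "(nat \<Rightarrow> 'a topology) \<Rightarrow> (nat \<Rightarrow> 'a \<Rightarrow> 'a set) \<Rightarrow> nat \<Rightarrow> 'a set \<Rightarrow> nat \<Rightarrow> nat \<Rightarrow> (nat \<Rightarrow> 'a) set" where
  "partial_threads X f n C a b =
     {x \<in> topspace (product_topology X UNIV).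
        x n \<in> C \<and> (\<forall>i. a \<le> i \<and> i < b \<longrightarrow> x i \<in> f i (x (Suc i)))}"

lemma compactum_product:
  fixes X :: "nat \<Rightarrow> 'a topology"
  assumes "\<And>i. compactum (X i)"
  shows "compactum (product_topology X UNIV)"
  using assms by (simp add: compactum_def compact_space_product_topology metrizable_space_product_topology)

lemma closedin_partial_threads:
  assumes inv: "inverse_sequence X f" and C: "closedin (X n) C"
  shows "closedin (product_topology X UNIV) (partial_threads X f n C a b)"
proof -
  let ?P = "product_topology X UNIV"
  have "closedin ?P {x \<in> topspace ?P. x i \<in> f i (x (Suc i))}" for i
  proof -
    have "continuous_map ?P (prod_topology (X (Suc i)) (X i)) (\<lambda>x. (x (Suc i), x i))"
      by (simp add: continuous_map_paired continuous_map_product_projection)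
    moreover have "closedin (prod_topology (X (Suc i)) (X i))
        {(x, y). x \<in> topspace (X (Suc i)) \<and> y \<in> topspace (X i) \<and> y \<in> f i x}"
      using inv by (intro closedin_graph)
        (auto simp: inverse_sequence_def compactum_def metrizable_imp_regular_space)
    ultimately have "closedin ?P {x \<in> topspace ?P. (x (Suc i), x i) \<in>
        {(x, y). x \<in> topspace (X (Suc i)) \<and> y \<in> topspace (X i) \<and> y \<in> f i x}}"
      by (rule closedin_continuous_map_preimage)
    also have "{x \<in> topspace ?P. (x (Suc i), x i) \<in>
        {(x, y). x \<in> topspace (X (Suc i)) \<and> y \<in> topspace (X i) \<and> y \<in> f i x}}
      = {x \<in> topspace ?P. x i \<in> f i (x (Suc i))}"
      by (auto simp: PiE_def)
    finally show ?thesis .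
  qed
  moreover have "closedin ?P {x \<in> topspace ?P. x n \<in> C}"
    using C by (intro closedin_continuous_map_preimage) (auto simp: continuous_map_product_projection)
  ultimately have "closedin ?P (\<Inter>(insert {x \<in> topspace ?P. x n \<in> C}
      ((\<lambda>i. {x \<in> topspace ?P. x i \<in> f i (x (Suc i))}) ` {a..<b})))"
    by (intro closedin_Inter) auto
  also have "\<Inter>(insert {x \<in> topspace ?P. x n \<in> C}
      ((\<lambda>i. {x \<in> topspace ?P. x i \<in> f i (x (Suc i))}) ` {a..<b})) = partial_threads X f n C a b"
    by (auto simp: partial_threads_def)
  finally show ?thesis .
qed

text \<open>The window grows from \<open>{n}\<close> one step at a time. A step down confines \<open>x m\<close> to the value
  \<open>f m (x (Suc m))\<close>; a step up confines \<open>x (Suc m)\<close> to the points whose value contains \<open>x m\<close>, a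
  set that is nonempty because \<open>f m\<close> is surjective. In either case the new coordinate was free
  before.\<close>

lemma connectedin_partial_threads:
  assumes inv: "inverse_sequence X f"
    and surj: "\<And>i. sv_surjective (X (Suc i)) (X i) (f i)"
    and mono: "\<And>i. sv_monotone (X (Suc i)) (X i) (f i)"
    and X: "\<And>i. continuum (X i)"
    and C: "subcontinuum (X n) C"
    and ab: "a \<le> n" "n \<le> b"
  shows "connectedin (product_topology X UNIV) (partial_threads X f n C a b)
    \<and> partial_threads X f n C a b \<noteq> {}"
proof -
  let ?P = "product_topology X UNIV"
  let ?conn = "\<lambda>a b. connectedin ?P (partial_threads X f n C a b) \<and> partial_threads X f n C a b \<noteq> {}"
  have cP: "compactum ?P"
    using inv by (intro compactum_product) (simp add: inverse_sequence_def)
  then have P: "compact_space ?P" "Hausdorff_space ?P"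
    using compactum_imp_Hausdorff by (auto simp: compactum_def)
  have C': "closedin (X n) C" "connectedin (X n) C" "C \<noteq> {}" "C \<subseteq> topspace (X n)"
    using C X[of n] closedin_subset by (auto simp: subcontinuum_iff continuum_def)
  note closed = closedin_partial_threads[OF inv C'(1)]
  have start: "?conn n n"
  proof -
    define S where "S = (\<lambda>i. if i = n then C else topspace (X i))"
    have "partial_threads X f n C n n = PiE UNIV S"
      using C'(4) by (auto simp: partial_threads_def S_def PiE_def Pi_def)
    moreover have "connectedin ?P (PiE UNIV S)"
      using C' X by (auto simp: connectedin_PiE S_def continuum_def connectedin_topspace)
    moreover have "PiE UNIV S \<noteq> {}"
      using C' X by (auto simp: PiE_eq_empty_iff S_def continuum_def)
    ultimately show ?thesis
      by simp
  qed
  have down: "?conn a n" if "a \<le> n" for a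
    using that
  proof (induction rule: inc_induct)
    case (step m)
    show ?case
    proof (rule connectedin_coordinate_constraint[OF P, where T = "partial_threads X f n C (Suc m) n"
          and k = m and D = "\<lambda>x. f m (x (Suc m))"])
      show "partial_threads X f n C m n
          = {x \<in> partial_threads X f n C (Suc m) n. x m \<in> f m (x (Suc m))}"
        using step.hyps by (auto simp: partial_threads_def Suc_le_eq) (metis le_neq_implies_less)
    next
      fix x z assume "x \<in> partial_threads X f n C (Suc m) n" "z \<in> topspace (X m)"
      then show "x(m := z) \<in> partial_threads X f n C (Suc m) n \<and>
          f m ((x(m := z)) (Suc m)) = f m (x (Suc m))"
        using step.hyps by (auto simp: partial_threads_def PiE_def)
    next
      fix x assume "x \<in> partial_threads X f n C (Suc m) n"
      then have "x (Suc m) \<in> topspace (X (Suc m))"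
        by (auto simp: partial_threads_def PiE_def)
      then show "connectedin (X m) (f m (x (Suc m))) \<and> f m (x (Suc m)) \<noteq> {}"
        using sv_monotone_connectedin_value[OF mono] mono[of m]
        by (fastforce simp: sv_monotone_def upper_semicontinuous_def closed_hyperspace_def)
    qed (use step.IH closed in auto)
  qed (rule start)
  show ?thesis
    using ab(2)
  proof (induction rule: dec_induct)
    case (step m)
    show ?case
    proof (rule connectedin_coordinate_constraint[OF P, where T = "partial_threads X f n C a m"
          and k = "Suc m" and D = "\<lambda>x. {z \<in> topspace (X (Suc m)). x m \<in> f m z}"])
      show "partial_threads X f n C a (Suc m)
          = {x \<in> partial_threads X f n C a m. x (Suc m) \<in> {z \<in> topspace (X (Suc m)). x m \<in> f m z}}"
        using step.hyps ab(1) by (auto simp: partial_threads_def less_Suc_eq PiE_def)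
    next
      fix x z assume "x \<in> partial_threads X f n C a m" "z \<in> topspace (X (Suc m))"
      then show "x(Suc m := z) \<in> partial_threads X f n C a m \<and>
          {w \<in> topspace (X (Suc m)). (x(Suc m := z)) m \<in> f m w}
            = {w \<in> topspace (X (Suc m)). x m \<in> f m w}"
        using step.hyps by (auto simp: partial_threads_def PiE_def)
    next
      fix x assume "x \<in> partial_threads X f n C a m"
      then have "x m \<in> topspace (X m)"
        by (auto simp: partial_threads_def PiE_def)
      then show "connectedin (X (Suc m)) {z \<in> topspace (X (Suc m)). x m \<in> f m z} \<and>
          {z \<in> topspace (X (Suc m)). x m \<in> f m z} \<noteq> {}"
        using sv_monotone_connectedin_preimage[OF mono] surj[of m]
        by (auto simp: sv_surjective_def)
    qed (use step.IH closed in auto)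
  qed (rule down[OF ab(1)])
qed

lemma topspace_inverse_limit:
  "topspace (inverse_limit X f)
     = {x \<in> topspace (product_topology X UNIV). \<forall>i. x i \<in> f i (x (Suc i))}"
  by (auto simp: inverse_limit_def)

text \<open>Monotonicity of the coordinate projections of the inverse limit, in the strong form that
  preimages of continua are continua; nonemptiness of the preimage says that they are surjective.\<close>

lemma subcontinuum_projection_preimage:
  assumes inv: "inverse_sequence X f"
    and surj: "\<And>i. sv_surjective (X (Suc i)) (X i) (f i)"
    and mono: "\<And>i. sv_monotone (X (Suc i)) (X i) (f i)"
    and X: "\<And>i. continuum (X i)"
    and C: "subcontinuum (X n) C"
  shows "subcontinuum (inverse_limit X f) {x \<in> topspace (inverse_limit X f). x n \<in> C}"
    (is "subcontinuum _ ?C")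
proof -
  let ?P = "product_topology X UNIV"
  have cP: "compactum ?P"
    using inv by (intro compactum_product) (simp add: inverse_sequence_def)
  then have P: "compact_space ?P" "Hausdorff_space ?P"
    using compactum_imp_Hausdorff by (auto simp: compactum_def)
  \<comment> \<open>The windows reach down to \<open>0\<close> from the start, so only their upper ends have to grow.\<close>
  define K where "K = (\<lambda>j. partial_threads X f n C 0 (n + j))"
  have "closedin (X n) C"
    using C X[of n] by (simp add: subcontinuum_iff continuum_def)
  then have clo: "closedin ?P (K j)" for j
    using closedin_partial_threads[OF inv] by (simp add: K_def)
  have con: "connectedin ?P (K j)" "K j \<noteq> {}" for j
    using connectedin_partial_threads[OF inv surj mono X C, of 0 "n + j"] by (auto simp: K_def)
  have dec: "decseq K"
    by (auto simp: K_def decseq_def partial_threads_def)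
  have "?C = (\<Inter>j. K j)"
  proof
    show "(\<Inter>j. K j) \<subseteq> ?C"
    proof
      fix x assume x: "x \<in> (\<Inter>j. K j)"
      have "x i \<in> f i (x (Suc i))" for i
        using INT_D[OF x, of "Suc i"] by (simp add: K_def partial_threads_def)
      then show "x \<in> ?C"
        using INT_D[OF x, of 0] by (simp add: K_def partial_threads_def topspace_inverse_limit)
    qed
  qed (auto simp: topspace_inverse_limit K_def partial_threads_def)
  moreover have "subcontinuum ?P (\<Inter>j. K j)"
    unfolding subcontinuum_iff[OF cP]
  proof (intro conjI)
    show "closedin ?P (\<Inter>j. K j)"
      by (rule closedin_Inter) (use clo in auto)
    show "connectedin ?P (\<Inter>j. K j)"
      by (rule connectedin_nest[OF P clo con(1) dec])
    show "(\<Inter>j. K j) \<noteq> {}"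
      by (rule compact_space_imp_nest[OF P(1) clo con(2) dec])
  qed
  moreover have "?C \<subseteq> {x \<in> topspace ?P. \<forall>i. x i \<in> f i (x (Suc i))}"
    by (auto simp: topspace_inverse_limit)
  ultimately show ?thesis
    unfolding inverse_limit_def by (subst subcontinuum_subtopology) auto
qed

lemma continuum_inverse_limit:
  assumes "inverse_sequence X f"
    and "\<And>i. sv_surjective (X (Suc i)) (X i) (f i)"
    and "\<And>i. sv_monotone (X (Suc i)) (X i) (f i)"
    and X: "\<And>i. continuum (X i)"
  shows "continuum (inverse_limit X f)"
proof -
  have "subcontinuum (X 0) (topspace (X 0))"
    using X[of 0] by (simp add: subcontinuum_def)
  then have "subcontinuum (inverse_limit X f)
      {x \<in> topspace (inverse_limit X f). x 0 \<in> topspace (X 0)}"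
    by (rule subcontinuum_projection_preimage[OF assms])
  moreover have "{x \<in> topspace (inverse_limit X f). x 0 \<in> topspace (X 0)}
      = topspace (inverse_limit X f)"
    by (auto simp: topspace_inverse_limit PiE_def)
  ultimately show ?thesis
    by (simp add: subcontinuum_def)
qed

theorem theorem4p8:
  fixes X :: "nat \<Rightarrow> 'a topology" and f :: "nat \<Rightarrow> 'a \<Rightarrow> 'a set"
  assumes "inverse_sequence X f"
    and "\<And>i. sv_surjective (X (Suc i)) (X i) (f i)"
    and "\<And>i. sv_monotone (X (Suc i)) (X i) (f i)"
    and "\<And>i. D_star_star_continuum (X i)"
  shows "D_star_star_continuum (inverse_limit X f)"
proof -
  let ?L = "inverse_limit X f"
  have X: "continuum (X i)" for i
    using assms(4) by (simp add: D_star_star_continuum_def)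
  have L: "continuum ?L"
    using assms(1-3) X by (rule continuum_inverse_limit)
  show ?thesis
    unfolding D_star_star_continuum_pointwise
  proof (intro conjI ballI allI impI, rule L, elim conjE)
    fix a B assume a: "a \<in> topspace ?L" and B: "subcontinuum ?L B" "nondegenerate B"
    \<comment> \<open>Two threads in \<open>B\<close> differ in some coordinate; this is the factor to work in.\<close>
    obtain x y where xy: "x \<in> B" "y \<in> B" "x \<noteq> y"
      using B(2) unfolding nondegenerate_def by blast
    then obtain n where n: "x n \<noteq> y n"
      by blast
    have proj: "continuous_map ?L (X n) (\<lambda>x. x n)"
      by (simp add: inverse_limit_def continuous_map_from_subtopology
          continuous_map_product_projection)
    have "subcontinuum (X n) ((\<lambda>x. x n) ` B)"
      using subcontinuum_continuous_image[OF _ _ proj B(1)] L X by (simp add: continuum_def)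
    moreover have "nondegenerate ((\<lambda>x. x n) ` B)"
      using xy n unfolding nondegenerate_def by blast
    moreover have "a n \<in> topspace (X n)"
      using a proj by (auto simp: continuous_map_def)
    ultimately obtain C where C: "subcontinuum (X n) C" "a n \<in> C"
        "(\<lambda>x. x n) ` B \<inter> C \<noteq> {}" "(\<lambda>x. x n) ` B - C \<noteq> {}"
      using assms(4)[of n] unfolding D_star_star_continuum_pointwise by meson
    have "subcontinuum ?L {x \<in> topspace ?L. x n \<in> C}"
      by (rule subcontinuum_projection_preimage[OF assms(1-3) X C(1)])
    moreover have "B \<subseteq> topspace ?L"
      using B(1) by (simp add: subcontinuum_def)
    ultimately show "\<exists>C. subcontinuum ?L C \<and> a \<in> C \<and> B \<inter> C \<noteq> {} \<and> B - C \<noteq> {}"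
      using C(2-4) a by (intro exI[of _ "{x \<in> topspace ?L. x n \<in> C}"]) blast
  qed
qed

end
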